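(* Let $L_\tau=(L,\tau)$ be a topoframe and let $f\in\mathcal{R}L_\tau$. Then the following statements hold. (1) For every $n\in\mathbb{N}=\{1,2,\dots\}$, if $z(f)\in\tau$, then $f\cdot(f_{\mathrm{coz}(f)})^n=f$ and $f\cdot (f_{z(f)})^n=\mathbf{0}$. (2) If $f$ is a nonunit element of $\mathcal{R}L_\tau$ and $z(f)\in\tau$, then $f$ is a zerodivisor. (3) If the principal ideal $(f)$ is a proper ideal of $\mathcal{R}L_\tau$ and $z(f)\in\tau$, then $(f)$ is a non-essential ideal.
   Context: A frame is a complete lattice $L$ (top $\top$, bottom $\bot$) with $a\wedge\bigvee S=\bigvee\{a\wedge s: s\in S\}$ for all $a\in L$, $S\subseteq L$. A frame homomorphism preserves finite meets (including $\top$) and arbitrary joins (including $\bot$). A topoframe $L_\tau$ is a pair $(L,\tau)$ where $L$ is a frame and $\tau$ is a subframe of $L$ all of whose elements are complemented in $L$. The complement in $L$ of a complemented element $a$ is denoted $a'$. A real-continuous function on $L_\tau$ is a frame homomorphism $f:\mathcal{P}(\mathbb{R})\to L$ (where $\mathcal P(\mathbb R)$ is the power set of $\mathbb R$) such that $f(\{x\in\mathbb R: p<x<q\})\in\tau$ for all $p,q\in\mathbb{Q}$. $\mathcal{R}L_\tau$ is the set of all these; it is a commutative (reduced) ring with identity under $(f\diamond g)(X)=\bigvee\{f(Y)\wedge g(Z): Y\diamond Z\subseteq X\}$ for $\diamond\in\{+,\cdot\}$, where $Y\diamond Z=\{y\diamond z: y\in Y, z\in Z\}$, with $(-f)(X)=f(-X)$,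 and with the constants $\mathbf{r}$ ($r\in\mathbb R$) given by $\mathbf r(X)=\top$ if $r\in X$ and $\bot$ otherwise; $\mathbf 0$ and $\mathbf 1$ are the zero and identity. For $f\in\mathcal{R}L_\tau$, $z(f)=f(\{0\})$ and $\mathrm{coz}(f)=f(\mathbb{R}\setminus\{0\})$, so $z(f)=\mathrm{coz}(f)'$ and $\mathrm{coz}(f)\in\tau$. For $a\in\tau$ with $a'\in\tau$, $f_a\in\mathcal{R}L_\tau$ is the (idempotent) real-continuous function with $f_a(X)=\top$ if $0,1\in X$; $f_a(X)=a'$ if $0\in X$, $1\notin X$; $f_a(X)=a$ if $0\notin X$, $1\in X$; $f_a(X)=\bot$ if $0,1\notin X$. A zerodivisor in a commutative ring is an element $x$ such that $xy=0$ for some $y\ne 0$ (so $0$ counts as a zerodivisor in a nonzero ring). An ideal $I$ of a ring $A$ is essential if $I\cap J\neq(0)$ for every non-zero ideal $J$ of $A$. *)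

theory Defs
  imports Complex_Main "HOL-Algebra.Ideal"
begin

hide_const (open) Order.top Lattice.inf Lattice.sup

text \<open>The class \<open>complete_distrib_lattice\<close> asks for complete distributivity,
  which is strictly stronger than the frame law.\<close>

class frame = complete_lattice +
  assumes inf_Sup_frame: "inf a (Sup S) = Sup {inf a s | s. s \<in> S}"

definition frame_hom :: "('a::complete_lattice \<Rightarrow> 'b::complete_lattice) \<Rightarrow> bool" where
  "frame_hom h \<longleftrightarrow>
     h top = top \<and> (\<forall>x y. h (inf x y) = inf (h x) (h y)) \<and> (\<forall>S. h (Sup S) = Sup (h ` S))"

definition is_complement :: "'a::bounded_lattice \<Rightarrow> 'a \<Rightarrow> bool" where
  "is_complement a b \<longleftrightarrow> inf a b = bot \<and> sup a b = top"

text \<open>In a frame, complements are unique when they exist; the value is meaningful only for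
  complemented elements.\<close>

definition complement :: "'a::bounded_lattice \<Rightarrow> 'a" where
  "complement a = (THE b. is_complement a b)"

text \<open>The bottom element belongs to \<open>\<tau>\<close> as the empty join.\<close>

locale topoframe =
  fixes \<tau> :: "'a::frame set"
  assumes top_mem: "top \<in> \<tau>"
    and inf_mem: "\<lbrakk>a \<in> \<tau>; b \<in> \<tau>\<rbrakk> \<Longrightarrow> inf a b \<in> \<tau>"
    and Sup_mem: "S \<subseteq> \<tau> \<Longrightarrow> Sup S \<in> \<tau>"
    and complemented: "a \<in> \<tau> \<Longrightarrow> \<exists>b. is_complement a b"

definition real_continuous :: "'a::frame set \<Rightarrow> (real set \<Rightarrow> 'a) \<Rightarrow> bool" where
  "real_continuous \<tau> f \<longleftrightarrow>
     frame_hom f \<and> (\<forall>p q::rat. f {x. of_rat p < x \<and> x < of_rat q} \<in> \<tau>)"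

definition rc_op ::
  "(real \<Rightarrow> real \<Rightarrow> real) \<Rightarrow> (real set \<Rightarrow> 'a::frame) \<Rightarrow> (real set \<Rightarrow> 'a) \<Rightarrow> real set \<Rightarrow> 'a" where
  "rc_op d f g X = Sup {inf (f Y) (g Z) | Y Z. {d y z | y z. y \<in> Y \<and> z \<in> Z} \<subseteq> X}"

definition rc_const :: "real \<Rightarrow> real set \<Rightarrow> 'a::frame" where
  "rc_const r X = (if r \<in> X then top else bot)"

definition RL :: "'a::frame set \<Rightarrow> (real set \<Rightarrow> 'a) ring" where
  "RL \<tau> = \<lparr>carrier = {f. real_continuous \<tau> f},
           mult = rc_op (*), one = rc_const 1,
           zero = rc_const 0, add = rc_op (+)\<rparr>"

definition zset :: "(real set \<Rightarrow> 'a::frame) \<Rightarrow> 'a" where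
  "zset f = f {0}"

definition coz :: "(real set \<Rightarrow> 'a::frame) \<Rightarrow> 'a" where
  "coz f = f (UNIV - {0})"

definition idem_fn :: "'a::frame \<Rightarrow> real set \<Rightarrow> 'a" where
  "idem_fn a X =
     (if 0 \<in> X \<and> 1 \<in> X then top
      else if 0 \<in> X then complement a
      else if 1 \<in> X then a
      else bot)"

definition zerodivisor :: "('b, 'm) ring_scheme \<Rightarrow> 'b \<Rightarrow> bool" where
  "zerodivisor R x \<longleftrightarrow>
     x \<in> carrier R \<and> (\<exists>y \<in> carrier R. y \<noteq> \<zero>\<^bsub>R\<^esub> \<and> x \<otimes>\<^bsub>R\<^esub> y = \<zero>\<^bsub>R\<^esub>)"

definition essential_ideal :: "'b set \<Rightarrow> ('b, 'm) ring_scheme \<Rightarrow> bool" where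
  "essential_ideal I R \<longleftrightarrow>
     ideal I R \<and> (\<forall>J. ideal J R \<and> J \<noteq> {\<zero>\<^bsub>R\<^esub>} \<longrightarrow> I \<inter> J \<noteq> {\<zero>\<^bsub>R\<^esub>})"

end

theory Submission
  imports Defs
begin

text \<open>
  A frame homomorphism \<open>f\<close> on the power set of the reals preserves all joins, so it is given by
  its values \<open>f {x}\<close> on points, and these values form a partition of \<open>top\<close>. Read
  \<open>a \<le> f {x}\<close> as ``on \<open>a\<close> the function \<open>f\<close> is constant with value \<open>x\<close>''. This reading makes
  real-continuous functions behave like ordinary functions: if \<open>f\<close> has value \<open>y\<close> and \<open>g\<close> has value
  \<open>z\<close> on \<open>a\<close>, then \<open>f \<diamondop> g\<close> has value \<open>y \<diamondop> z\<close> on \<open>a\<close> (\<open>rc_op_at_point\<close>), and two functions are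
  equal as soon as \<open>top\<close> is partitioned into elements on each of which they take a common value
  (\<open>frame_hom_eqI_local\<close>). Every equation between real-continuous functions thus reduces to an
  equation between real numbers, checked on the common refinement of the partitions of the
  functions involved. This yields the commutative ring axioms (\<open>cring_RL\<close>) and, by separating
  the value \<open>0\<close> of \<open>f\<close> from the others, the idempotency of \<open>idem_fn\<close> and part (1): on \<open>z(f)\<close>
  the value of \<open>f\<close> is \<open>0\<close>, while on its complement \<open>coz(f)\<close> the factor \<open>idem_fn (coz f)\<close>
  is \<open>1\<close> and the factor \<open>idem_fn (zset f)\<close> is \<open>0\<close>.

  For the other parts, \<open>f\<close> is invertible when \<open>z(f) = bot\<close>: the pointwise
  reciprocal is discontinuous only at \<open>0\<close>, a point that \<open>f\<close> does not see (\<open>Units_RL\<close>). So if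
  \<open>f\<close> is not a unit, \<open>e = idem_fn (zset f)\<close> is nonzero, and \<open>f e = 0\<close> makes \<open>f\<close> a zerodivisor.
  Since \<open>e\<close> is idempotent, \<open>(f)\<close> and the nonzero ideal \<open>(e)\<close> meet in \<open>0\<close> only, because
  \<open>x = r f = s e\<close> implies \<open>x = s e e = r f e = 0\<close>; hence \<open>(f)\<close> is not essential.
\<close>

section \<open>Frames\<close>

lemma inf_SUP_frame: "inf a (SUP i\<in>I. b i) = (SUP i\<in>I. inf a (b i :: 'a::frame))"
proof -
  have "{inf a s |s. s \<in> b ` I} = (\<lambda>i. inf a (b i)) ` I" by auto
  then show ?thesis by (simp add: inf_Sup_frame)
qed

lemma le_if_le_on_cover:
  fixes x y :: "'a::frame"
  assumes cover: "Sup C = top" and le: "\<And>a. a \<in> C \<Longrightarrow> inf a x \<le> y"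
  shows "x \<le> y"
proof -
  have "x = inf x (Sup C)" using cover by simp
  also have "\<dots> = Sup {inf x a |a. a \<in> C}" by (rule inf_Sup_frame)
  also have "\<dots> \<le> y" using le by (auto intro!: Sup_least simp: inf_commute)
  finally show ?thesis .
qed

lemma complement_eqI:
  fixes a b :: "'a::frame"
  assumes "is_complement a b"
  shows "complement a = b"
proof -
  have le: "c \<le> d" if "is_complement a c" "is_complement a d" for c d :: 'a
  proof (rule le_if_le_on_cover)
    show "Sup {a, d} = top" using that by (simp add: is_complement_def)
    show "inf u c \<le> d" if "u \<in> {a, d}" for u
      using that \<open>is_complement a c\<close> by (auto simp: is_complement_def)
  qed
  show ?thesis
    unfolding complement_def using assms le by (blast intro: the_equality antisym)
qed

lemma is_complement_sym: "is_complement a b \<Longrightarrow> is_complement b a"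
  by (simp add: is_complement_def inf_commute sup_commute)

section \<open>Frame homomorphisms as partitions of the top element\<close>

definition partition_of_top :: "('i \<Rightarrow> 'a::frame) \<Rightarrow> bool" where
  "partition_of_top a \<longleftrightarrow> (\<forall>i j. i \<noteq> j \<longrightarrow> inf (a i) (a j) = bot) \<and> (SUP i. a i) = top"

text \<open>The index type is arbitrary because a function computed from two others is most naturally
  indexed by pairs of values, and then pushed forward to the reals along the operation.\<close>

lemma frame_hom_pushforward:
  fixes a :: "'i \<Rightarrow> 'a::frame"
  assumes "partition_of_top a"
  shows "frame_hom (\<lambda>X. SUP i\<in>\<phi> -` X. a i)"
proof -
  have meet: "(SUP i\<in>\<phi> -` (X \<inter> Y). a i) = inf (SUP i\<in>\<phi> -` X. a i) (SUP i\<in>\<phi> -` Y. a i)"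
    for X Y
  proof (rule antisym)
    show "(SUP i\<in>\<phi> -` (X \<inter> Y). a i) \<le> inf (SUP i\<in>\<phi> -` X. a i) (SUP i\<in>\<phi> -` Y. a i)"
      by (intro le_infI SUP_subset_mono) auto
    have "inf (a i) (a j) \<le> (SUP i\<in>\<phi> -` (X \<inter> Y). a i)" if "\<phi> i \<in> X" "\<phi> j \<in> Y" for i j
    proof (cases "i = j")
      case True
      then show ?thesis using that by (auto intro: SUP_upper)
    next
      case False
      then show ?thesis using assms by (simp add: partition_of_top_def)
    qed
    then show "inf (SUP i\<in>\<phi> -` X. a i) (SUP i\<in>\<phi> -` Y. a i) \<le> (SUP i\<in>\<phi> -` (X \<inter> Y). a i)"
      by (simp add: inf_SUP_frame inf_commute[of "Sup _"])
         (intro SUP_least, subst inf_commute, simp)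
  qed
  have join: "(SUP i\<in>\<phi> -` \<Union>S. a i) = (SUP X\<in>S. SUP i\<in>\<phi> -` X. a i)" for S
    by (rule antisym) (auto intro!: SUP_least intro: SUP_upper SUP_upper2)
  show ?thesis
    using assms meet join by (simp add: frame_hom_def partition_of_top_def)
qed

lemma partition_of_top_inf:
  fixes a :: "'i \<Rightarrow> 'a::frame" and b :: "'j \<Rightarrow> 'a"
  assumes a: "partition_of_top a" and b: "partition_of_top b"
  shows "partition_of_top (\<lambda>p. inf (a (fst p)) (b (snd p)))"
proof -
  have "inf (inf (a i) (b j)) (inf (a k) (b l)) = bot" if "(i, j) \<noteq> (k, l)" for i j k l
  proof -
    have "inf (inf (a i) (b j)) (inf (a k) (b l)) = inf (inf (a i) (a k)) (inf (b j) (b l))"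
      by (simp add: inf_aci)
    also have "\<dots> = bot" using that a b by (auto simp: partition_of_top_def)
    finally show ?thesis .
  qed
  moreover have "(SUP p. inf (a (fst p)) (b (snd p))) = top"
  proof -
    have "inf (a i) top \<le> (SUP p. inf (a (fst p)) (b (snd p)))" for i
    proof -
      have "inf (a i) top = (SUP j. inf (a i) (b j))"
        using b inf_SUP_frame[of "a i" b UNIV] by (simp add: partition_of_top_def)
      also have "\<dots> \<le> (SUP p. inf (a (fst p)) (b (snd p)))"
      proof (rule SUP_least)
        show "inf (a i) (b j) \<le> (SUP p. inf (a (fst p)) (b (snd p)))" for j
          by (rule SUP_upper2[of "(i, j)"]) auto
      qed
      finally show ?thesis .
    qed
    then have "(SUP i. a i) \<le> (SUP p. inf (a (fst p)) (b (snd p)))"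
      by (intro SUP_least) simp
    then show ?thesis using a by (simp add: partition_of_top_def top_unique)
  qed
  ultimately show ?thesis by (auto simp: partition_of_top_def)
qed

lemma frame_hom_inf: "frame_hom f \<Longrightarrow> f (X \<inter> Y) = inf (f X) (f Y)"
  by (simp add: frame_hom_def)

lemma frame_hom_Union: "frame_hom f \<Longrightarrow> f (\<Union>S) = (SUP X\<in>S. f X)"
  by (simp add: frame_hom_def)

lemma frame_hom_empty:
  assumes "frame_hom f" shows "f {} = bot"
  using frame_hom_Union[OF assms, of "{}"] by simp

lemma frame_hom_UNIV: "frame_hom f \<Longrightarrow> f UNIV = top"
  by (simp add: frame_hom_def)

lemma frame_hom_mono: "frame_hom f \<Longrightarrow> X \<subseteq> Y \<Longrightarrow> f X \<le> f Y"
  by (metis frame_hom_inf inf.absorb_iff1)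

lemma frame_hom_SUP_singletons:
  assumes "frame_hom f"
  shows "f X = (SUP x\<in>X. f {x})"
  using frame_hom_Union[OF assms, of "(\<lambda>x. {x}) ` X"] by (simp add: image_comp)

lemma partition_of_top_singletons:
  fixes f :: "'b set \<Rightarrow> 'a::frame"
  assumes "frame_hom f"
  shows "partition_of_top (\<lambda>x. f {x})"
proof -
  have "inf (f {x}) (f {y}) = bot" if "x \<noteq> y" for x y
    using that frame_hom_inf[OF assms, of "{x}" "{y}"] frame_hom_empty[OF assms] by simp
  then show ?thesis
    using frame_hom_SUP_singletons[OF assms, of UNIV] frame_hom_UNIV[OF assms]
    by (simp add: partition_of_top_def)
qed

lemma frame_hom_vimage:
  assumes "frame_hom f"
  shows "frame_hom (\<lambda>X. f (\<phi> -` X))"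
proof -
  have "f (\<phi> -` \<Union>S) = (SUP X\<in>S. f (\<phi> -` X))" for S
    using frame_hom_Union[OF assms, of "(\<lambda>X. \<phi> -` X) ` S"] by (simp add: vimage_Union image_comp)
  then show ?thesis
    using assms by (simp add: frame_hom_def)
qed

text \<open>On a member \<open>a\<close> of the partition \<open>c\<close>, with common value \<open>x\<close>, both \<open>F X\<close> and \<open>G X\<close> restrict to
  \<open>a\<close> or to \<open>bot\<close>, according to whether \<open>x \<in> X\<close>.\<close>

lemma frame_hom_eqI_local:
  fixes F G :: "'b set \<Rightarrow> 'a::frame"
  assumes "frame_hom F" "frame_hom G" and part: "partition_of_top c"
    and loc: "\<And>i. \<exists>x. c i \<le> F {x} \<and> c i \<le> G {x}"
  shows "F = G"
proof -
  have le: "F X \<le> G X"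
    if F: "frame_hom F" and G: "frame_hom G" and loc: "\<And>i. \<exists>x. c i \<le> F {x} \<and> c i \<le> G {x}"
    for F G :: "'b set \<Rightarrow> 'a" and X
  proof (rule le_if_le_on_cover)
    show "Sup (range c) = top" using part by (simp add: partition_of_top_def)
    fix a assume "a \<in> range c"
    then obtain x where x: "a \<le> F {x}" "a \<le> G {x}" using loc by auto
    show "inf a (F X) \<le> G X"
    proof (cases "x \<in> X")
      case True
      then have "a \<le> G X" using x(2) frame_hom_mono[OF G, of "{x}" X] by (auto intro: order_trans)
      then show ?thesis by (rule le_infI1)
    next
      case False
      then have "inf (F {x}) (F X) = bot"
        using frame_hom_inf[OF F, of "{x}" X] frame_hom_empty[OF F] by simp
      then show ?thesis using x(1) by (metis bot.extremum inf_mono order_refl order_trans)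
    qed
  qed
  show ?thesis
    using le[OF assms(1,2) loc] le[OF assms(2,1)] loc by (blast intro: antisym)
qed

section \<open>Pointwise operations and continuity\<close>

lemma rc_op_at_point:
  assumes "a \<le> f {y}" "a \<le> g {z}"
  shows "a \<le> rc_op d f g {d y z}"
proof -
  have "inf (f {y}) (g {z}) \<le> rc_op d f g {d y z}"
    unfolding rc_op_def by (rule Sup_upper) blast
  then show ?thesis using assms by (meson le_inf_iff order_trans)
qed

text \<open>The join in the definition of the operation does not change when it is restricted to
  pairs of points, because \<open>f\<close> and \<open>g\<close> preserve joins. This exhibits the result as a pushforward of the refined partition.\<close>

lemma rc_op_eq_pushforward:
  assumes f: "frame_hom f" and g: "frame_hom g"
  shows "rc_op d f g X
    = (SUP p\<in>(\<lambda>p. d (fst p) (snd p)) -` X. inf (f {fst p}) (g {snd p}))" (is "_ = ?S")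
proof (rule antisym)
  have "inf (f Y) (g Z) \<le> ?S" if "{d y z |y z. y \<in> Y \<and> z \<in> Z} \<subseteq> X" for Y Z
  proof -
    have "inf (f Y) (g Z) = inf (SUP y\<in>Y. f {y}) (SUP z\<in>Z. g {z})"
      using frame_hom_SUP_singletons[OF f, of Y] frame_hom_SUP_singletons[OF g, of Z] by simp
    also have "\<dots> = (SUP z\<in>Z. SUP y\<in>Y. inf (f {y}) (g {z}))"
      by (simp add: inf_SUP_frame inf_commute)
    also have "\<dots> \<le> ?S"
    proof (intro SUP_least)
      fix y z assume "z \<in> Z" "y \<in> Y"
      then show "inf (f {y}) (g {z}) \<le> ?S"
        using that by (intro SUP_upper2[of "(y, z)"]) auto
    qed
    finally show ?thesis .
  qed
  then show "rc_op d f g X \<le> ?S"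
    unfolding rc_op_def by (auto intro!: Sup_least)
  show "?S \<le> rc_op d f g X"
    unfolding rc_op_def by (rule SUP_least, rule Sup_upper) auto
qed

lemma frame_hom_rc_op:
  assumes "frame_hom f" "frame_hom g"
  shows "frame_hom (rc_op d f g)"
proof -
  have "frame_hom (\<lambda>X. SUP p\<in>(\<lambda>p. d (fst p) (snd p)) -` X. inf (f {fst p}) (g {snd p}))"
    using assms by (intro frame_hom_pushforward partition_of_top_inf partition_of_top_singletons)
  then show ?thesis
    unfolding rc_op_eq_pushforward[OF assms, symmetric] .
qed

lemma frame_hom_rc_const: "frame_hom (rc_const r :: real set \<Rightarrow> 'a::frame)"
proof -
  have "rc_const r = (\<lambda>X. SUP i\<in>(\<lambda>_::unit. r) -` X. top :: 'a)"
    by (auto simp: rc_const_def fun_eq_iff)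
  moreover have "partition_of_top (\<lambda>_::unit. top :: 'a)"
    by (simp add: partition_of_top_def)
  ultimately show ?thesis
    using frame_hom_pushforward by metis
qed

lemma frame_hom_idem_fn:
  assumes "is_complement a (b :: 'a::frame)"
  shows "frame_hom (idem_fn a)"
proof -
  let ?\<phi> = "\<lambda>i. if i then 1 else 0 :: real" and ?c = "\<lambda>i. if i then a else b"
  have "idem_fn a X = (SUP i\<in>?\<phi> -` X. ?c i)" for X
  proof -
    have "?\<phi> -` X = (if 1 \<in> X then {True} else {}) \<union> (if 0 \<in> X then {False} else {})"
      by (auto split: if_splits)
    then show ?thesis
      using assms complement_eqI[OF assms] by (simp add: idem_fn_def is_complement_def sup_commute)
  qed
  moreover have "partition_of_top ?c"
    using assms by (simp add: partition_of_top_def is_complement_def UNIV_bool inf_commute sup_commute)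
  ultimately show ?thesis
    using frame_hom_pushforward[of ?c ?\<phi>] by presburger
qed

lemma idem_fn_at_one: "idem_fn a {1} = a"
  by (simp add: idem_fn_def)

lemma idem_fn_at_zero: "is_complement a b \<Longrightarrow> idem_fn a {0} = (b :: 'a::frame)"
  by (simp add: idem_fn_def complement_eqI)

text \<open>The rational open intervals form a base of the topology of the reals, and \<open>\<tau>\<close> is closed
  under arbitrary joins.\<close>

lemma real_continuous_iff_open:
  assumes "topoframe \<tau>"
  shows "real_continuous \<tau> f \<longleftrightarrow> frame_hom f \<and> (\<forall>U. open U \<longrightarrow> f U \<in> \<tau>)"
proof
  assume R: "real_continuous \<tau> f"
  then have f: "frame_hom f" by (simp add: real_continuous_def)
  have "f U \<in> \<tau>" if U: "open U" for U
  proof -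
    let ?I = "\<lambda>p q :: rat. {x::real. of_rat p < x \<and> x < of_rat q}"
    let ?S = "{?I p q |p q. ?I p q \<subseteq> U}"
    have "x \<in> \<Union>?S" if x: "x \<in> U" for x
    proof -
      obtain e where e: "e > 0" "\<And>y. dist y x < e \<Longrightarrow> y \<in> U"
        using U x by (meson open_dist)
      obtain p where p: "x - e < of_rat p" "of_rat p < x"
        using of_rat_dense[of "x - e" x] e by auto
      obtain q where q: "x < of_rat q" "of_rat q < x + e"
        using of_rat_dense[of x "x + e"] e by auto
      have "?I p q \<subseteq> U" using p q by (auto intro!: e(2) simp: dist_real_def)
      then show ?thesis using p q by blast
    qed
    then have "U = \<Union>?S" by blast
    then have "f U = (SUP X\<in>?S. f X)" using frame_hom_Union[OF f] by metis
    moreover have "f ` ?S \<subseteq> \<tau>" using R by (auto simp: real_continuous_def)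
    ultimately show ?thesis using topoframe.Sup_mem[OF assms] by simp
  qed
  then show "frame_hom f \<and> (\<forall>U. open U \<longrightarrow> f U \<in> \<tau>)" using f by blast
next
  assume R: "frame_hom f \<and> (\<forall>U. open U \<longrightarrow> f U \<in> \<tau>)"
  have "open {x::real. of_rat p < x \<and> x < of_rat q}" for p q
    using open_real_greaterThanLessThan[of "of_rat p" "of_rat q"]
    by (simp add: greaterThanLessThan_def greaterThan_def lessThan_def Collect_conj_eq)
  then show "real_continuous \<tau> f" using R by (simp add: real_continuous_def)
qed

lemma bot_mem_topoframe: "topoframe \<tau> \<Longrightarrow> bot \<in> \<tau>"
  using topoframe.Sup_mem[of \<tau> "{}"] by simp

text \<open>Preimages of open sets under a continuous operation are unions of open rectangles, and a
  rectangle \<open>A \<times> B\<close> contributes \<open>inf (f A) (g B) \<in> \<tau>\<close>.\<close>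

lemma real_continuous_rc_op:
  assumes \<tau>: "topoframe \<tau>" and f: "real_continuous \<tau> f" and g: "real_continuous \<tau> g"
    and d: "continuous_on UNIV (\<lambda>p. d (fst p) (snd p))"
  shows "real_continuous \<tau> (rc_op d f g)"
proof -
  have hom: "frame_hom f" "frame_hom g"
    using f g by (simp_all add: real_continuous_def)
  have "rc_op d f g U \<in> \<tau>" if U: "open U" for U
  proof -
    let ?W = "(\<lambda>p. d (fst p) (snd p)) -` U"
    let ?S = "{inf (f A) (g B) |A B. open A \<and> open B \<and> A \<times> B \<subseteq> ?W}"
    have W: "open ?W" using open_vimage[OF U d] .
    have "rc_op d f g U = Sup ?S"
    proof (rule antisym)
      have "inf (f {fst p}) (g {snd p}) \<le> Sup ?S" if p: "p \<in> ?W" for p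
      proof -
        obtain A B where AB: "open A" "open B" "p \<in> A \<times> B" "A \<times> B \<subseteq> ?W"
          by (rule open_prod_elim[OF W p])
        then have "inf (f {fst p}) (g {snd p}) \<le> inf (f A) (g B)"
          using frame_hom_mono[OF hom(1), of "{fst p}" A] frame_hom_mono[OF hom(2), of "{snd p}" B]
          by (intro inf_mono) auto
        also have "\<dots> \<le> Sup ?S" using AB by (intro Sup_upper) blast
        finally show ?thesis .
      qed
      then show "rc_op d f g U \<le> Sup ?S"
        unfolding rc_op_eq_pushforward[OF hom] by (rule SUP_least)
      show "Sup ?S \<le> rc_op d f g U"
        unfolding rc_op_def by (rule Sup_subset_mono) fastforce
    qed
    moreover have "?S \<subseteq> \<tau>"
      using f g topoframe.inf_mem[OF \<tau>] by (auto simp: real_continuous_iff_open[OF \<tau>])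
    ultimately show ?thesis using topoframe.Sup_mem[OF \<tau>] by simp
  qed
  then show ?thesis
    using frame_hom_rc_op[OF hom] by (simp add: real_continuous_iff_open[OF \<tau>])
qed

lemma real_continuous_rc_const: "topoframe \<tau> \<Longrightarrow> real_continuous \<tau> (rc_const r)"
  using topoframe.top_mem[of \<tau>] bot_mem_topoframe[of \<tau>]
  by (simp add: real_continuous_iff_open frame_hom_rc_const) (simp add: rc_const_def)

lemma real_continuous_idem_fn:
  assumes "topoframe \<tau>" "is_complement a b" "a \<in> \<tau>" "b \<in> \<tau>"
  shows "real_continuous \<tau> (idem_fn a)"
  using assms
  by (auto simp: real_continuous_iff_open frame_hom_idem_fn idem_fn_def complement_eqI
        topoframe.top_mem bot_mem_topoframe)

section \<open>The ring of real-continuous functions\<close>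

lemma RL_simps:
  "f \<in> carrier (RL \<tau>) \<longleftrightarrow> real_continuous \<tau> f"
  "f \<otimes>\<^bsub>RL \<tau>\<^esub> g = rc_op (*) f g" "f \<oplus>\<^bsub>RL \<tau>\<^esub> g = rc_op (+) f g"
  "\<one>\<^bsub>RL \<tau>\<^esub> = rc_const 1" "\<zero>\<^bsub>RL \<tau>\<^esub> = rc_const 0"
  by (simp_all add: RL_def)

lemma real_continuous_frame_hom: "real_continuous \<tau> f \<Longrightarrow> frame_hom f"
  by (simp add: real_continuous_def)

text \<open>The pointwise form of an equation in three functions: on each member of the refined
  partition all three functions are constant, so it is enough to find a common value of both sides
  there.\<close>

lemma frame_hom_eqI_three:
  fixes f g h F G :: "real set \<Rightarrow> 'a::frame"
  assumes "frame_hom f" "frame_hom g" "frame_hom h" "frame_hom F" "frame_hom G"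
    and "\<And>a x y z. \<lbrakk>a \<le> f {x}; a \<le> g {y}; a \<le> h {z}\<rbrakk> \<Longrightarrow> \<exists>w. a \<le> F {w} \<and> a \<le> G {w}"
  shows "F = G"
proof (rule frame_hom_eqI_local)
  let ?c = "\<lambda>p. inf (inf (f {fst (fst p)}) (g {snd (fst p)})) (h {snd p})"
  show "partition_of_top ?c"
    using assms(1-3)
      partition_of_top_inf[OF partition_of_top_inf[of "\<lambda>x. f {x}" "\<lambda>x. g {x}"], of "\<lambda>x. h {x}"]
    by (simp add: partition_of_top_singletons)
  show "\<exists>w. ?c p \<le> F {w} \<and> ?c p \<le> G {w}" for p
    by (rule assms(6)) (auto intro: le_infI1 le_infI2)
qed (use assms in auto)

lemma rc_op_commute:
  assumes f: "frame_hom f" and g: "frame_hom g" and d: "\<And>x y. d x y = d y x"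
  shows "rc_op d f g = rc_op d g f"
proof (rule frame_hom_eqI_three[OF f g g])
  fix a x y assume "a \<le> f {x}" "a \<le> g {y}"
  then have "a \<le> rc_op d f g {d x y}" "a \<le> rc_op d g f {d y x}"
    by - (intro rc_op_at_point; assumption)+
  then show "\<exists>w. a \<le> rc_op d f g {w} \<and> a \<le> rc_op d g f {w}"
    using d[of x y] by auto
qed (use f g in \<open>simp_all add: frame_hom_rc_op\<close>)

lemma rc_op_assoc:
  assumes hom: "frame_hom f" "frame_hom g" "frame_hom h"
    and d: "\<And>x y z. d (d x y) z = d x (d y z)"
  shows "rc_op d (rc_op d f g) h = rc_op d f (rc_op d g h)" (is "?F = ?G")
proof (rule frame_hom_eqI_three[OF hom])
  fix a x y z assume "a \<le> f {x}" "a \<le> g {y}" "a \<le> h {z}"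
  then have "a \<le> ?F {d (d x y) z}" "a \<le> ?G {d x (d y z)}"
    by - (intro rc_op_at_point; assumption)+
  then show "\<exists>w. a \<le> ?F {w} \<and> a \<le> ?G {w}"
    using d[of x y z] by auto
qed (use hom in \<open>simp_all add: frame_hom_rc_op\<close>)

lemma rc_op_distrib:
  assumes hom: "frame_hom f" "frame_hom g" "frame_hom h"
    and d: "\<And>x y z. d (e x y) z = e (d x z) (d y z)"
  shows "rc_op d (rc_op e f g) h = rc_op e (rc_op d f h) (rc_op d g h)" (is "?F = ?G")
proof (rule frame_hom_eqI_three[OF hom])
  fix a x y z assume "a \<le> f {x}" "a \<le> g {y}" "a \<le> h {z}"
  then have "a \<le> ?F {d (e x y) z}" "a \<le> ?G {e (d x z) (d y z)}"
    by - (intro rc_op_at_point; assumption)+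
  then show "\<exists>w. a \<le> ?F {w} \<and> a \<le> ?G {w}"
    using d[of x y z] by auto
qed (use hom in \<open>simp_all add: frame_hom_rc_op\<close>)

lemma rc_op_const_left:
  assumes "frame_hom f" and d: "\<And>x. d r x = x"
  shows "rc_op d (rc_const r) f = f"
proof (rule frame_hom_eqI_local[OF _ _ partition_of_top_singletons[OF assms(1)]])
  show "\<exists>x. f {y} \<le> rc_op d (rc_const r) f {x} \<and> f {y} \<le> f {x}" for y
    using rc_op_at_point[of "f {y}" "rc_const r" r f y d] d by (auto simp: rc_const_def)
qed (use assms in \<open>simp_all add: frame_hom_rc_op frame_hom_rc_const\<close>)

text \<open>With \<open>\<phi>\<close> the negation or the reciprocal, this says that composing \<open>f\<close> with \<open>\<phi>\<close> gives its
  inverse. The value \<open>0\<close> has to be exempted for reciprocals, which is harmless where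
  \<open>f {0} = bot\<close>.\<close>

lemma rc_op_inverse:
  assumes f: "frame_hom f" and d: "\<And>x. f {x} = bot \<or> d (\<phi> x) x = r"
  shows "rc_op d (\<lambda>X. f (\<phi> -` X)) f = rc_const r"
proof (rule frame_hom_eqI_local[OF _ _ partition_of_top_singletons[OF f]])
  show "\<exists>x. f {y} \<le> rc_op d (\<lambda>X. f (\<phi> -` X)) f {x} \<and> f {y} \<le> rc_const r {x}" for y
  proof (cases "f {y} = bot")
    case False
    have "f {y} \<le> f (\<phi> -` {\<phi> y})" by (rule frame_hom_mono[OF f]) auto
    then have "f {y} \<le> rc_op d (\<lambda>X. f (\<phi> -` X)) f {d (\<phi> y) y}"
      using rc_op_at_point[of "f {y}" "\<lambda>X. f (\<phi> -` X)"] by blast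
    then show ?thesis using d[of y] False by (auto simp: rc_const_def)
  qed simp
qed (use f in \<open>simp_all add: frame_hom_rc_op frame_hom_rc_const frame_hom_vimage\<close>)

lemma cring_RL:
  assumes \<tau>: "topoframe \<tau>"
  shows "cring (RL \<tau>)"
proof (rule cringI)
  note [simp] = RL_simps real_continuous_rc_const[OF \<tau>] real_continuous_frame_hom[of \<tau>]
  have add: "real_continuous \<tau> (rc_op (+) f g)"
    if "real_continuous \<tau> f" "real_continuous \<tau> g" for f g
    using that by (rule real_continuous_rc_op[OF \<tau>]) (intro continuous_intros)
  have mult: "real_continuous \<tau> (rc_op (*) f g)"
    if "real_continuous \<tau> f" "real_continuous \<tau> g" for f g
    using that by (rule real_continuous_rc_op[OF \<tau>]) (intro continuous_intros)
  have neg: "real_continuous \<tau> (\<lambda>X. f (uminus -` X))" if "real_continuous \<tau> f" for f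
  proof -
    have "open (uminus -` U)" if "open U" for U :: "real set"
      using that by (rule open_vimage) (intro continuous_intros)
    then show ?thesis
      using \<open>real_continuous \<tau> f\<close> by (simp add: real_continuous_iff_open[OF \<tau>] frame_hom_vimage)
  qed
  show "abelian_group (RL \<tau>)"
  proof (rule abelian_groupI)
    fix f assume f: "f \<in> carrier (RL \<tau>)"
    have "rc_op (+) (\<lambda>X. f (uminus -` X)) f = rc_const 0"
      using f by (intro rc_op_inverse) simp_all
    then show "\<exists>g\<in>carrier (RL \<tau>). g \<oplus>\<^bsub>RL \<tau>\<^esub> f = \<zero>\<^bsub>RL \<tau>\<^esub>"
      using f neg by (intro bexI[of _ "\<lambda>X. f (uminus -` X)"]) simp_all
  qed (simp_all add: add,
      (rule rc_op_assoc rc_op_commute rc_op_const_left; simp add: add.commute)+)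
  show "comm_monoid (RL \<tau>)"
    by (rule comm_monoidI) (simp_all add: mult,
      (rule rc_op_assoc rc_op_commute rc_op_const_left; simp add: mult.commute)+)
  show "(f \<oplus>\<^bsub>RL \<tau>\<^esub> g) \<otimes>\<^bsub>RL \<tau>\<^esub> h = f \<otimes>\<^bsub>RL \<tau>\<^esub> h \<oplus>\<^bsub>RL \<tau>\<^esub> g \<otimes>\<^bsub>RL \<tau>\<^esub> h"
    if "f \<in> carrier (RL \<tau>)" "g \<in> carrier (RL \<tau>)" "h \<in> carrier (RL \<tau>)" for f g h
    using that by simp (rule rc_op_distrib; simp add: distrib_right)
qed

section \<open>Zero sets, idempotents and units\<close>

lemma is_complement_zset_coz:
  assumes "frame_hom f"
  shows "is_complement (zset f) (coz f)"
proof -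
  have "inf (f {0}) (f (UNIV - {0})) = bot"
    using frame_hom_inf[OF assms, of "{0}" "UNIV - {0}"] frame_hom_empty[OF assms] by simp
  moreover have "sup (f {0}) (f (UNIV - {0})) = top"
    using frame_hom_Union[OF assms, of "{{0}, UNIV - {0}}"] frame_hom_UNIV[OF assms]
    by (simp add: insert_UNIV)
  ultimately show ?thesis by (simp add: is_complement_def zset_def coz_def)
qed

lemma le_coz: "frame_hom f \<Longrightarrow> y \<noteq> 0 \<Longrightarrow> f {y} \<le> coz f"
  unfolding coz_def by (rule frame_hom_mono) auto

lemma coz_mem: "topoframe \<tau> \<Longrightarrow> real_continuous \<tau> f \<Longrightarrow> coz f \<in> \<tau>"
  by (simp add: real_continuous_iff_open coz_def open_Diff)

lemma rc_mult_idem_coz: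
  assumes f: "frame_hom f"
  shows "rc_op (*) f (idem_fn (coz f)) = f"
proof (rule frame_hom_eqI_local[OF _ _ partition_of_top_singletons[OF f]])
  note compl = is_complement_sym[OF is_complement_zset_coz[OF f]]
  show "frame_hom (rc_op (*) f (idem_fn (coz f)))"
    by (intro frame_hom_rc_op f frame_hom_idem_fn[OF compl])
  show "\<exists>x. f {y} \<le> rc_op (*) f (idem_fn (coz f)) {x} \<and> f {y} \<le> f {x}" for y
  proof (cases "y = 0")
    case True
    then have "f {y} \<le> idem_fn (coz f) {0}"
      by (simp add: idem_fn_at_zero[OF compl] zset_def)
    from rc_op_at_point[where f = f and g = "idem_fn (coz f)" and y = y and z = 0 and d = "(*)", OF order_refl this] True show ?thesis by auto
  next
    case False
    then have "f {y} \<le> idem_fn (coz f) {1}"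
      by (simp add: idem_fn_at_one le_coz[OF f])
    from rc_op_at_point[where f = f and g = "idem_fn (coz f)" and y = y and z = 1 and d = "(*)", OF order_refl this] show ?thesis by auto
  qed
qed (rule f)

lemma rc_mult_idem_zset:
  assumes f: "frame_hom f"
  shows "rc_op (*) f (idem_fn (zset f)) = rc_const 0"
proof (rule frame_hom_eqI_local[OF _ frame_hom_rc_const partition_of_top_singletons[OF f]])
  note compl = is_complement_zset_coz[OF f]
  show "frame_hom (rc_op (*) f (idem_fn (zset f)))"
    by (intro frame_hom_rc_op f frame_hom_idem_fn[OF compl])
  show "\<exists>x. f {y} \<le> rc_op (*) f (idem_fn (zset f)) {x} \<and> f {y} \<le> rc_const 0 {x}" for y
  proof (cases "y = 0")
    case True
    then have "f {y} \<le> idem_fn (zset f) {1}"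
      by (simp add: idem_fn_at_one zset_def)
    from rc_op_at_point[where f = f and g = "idem_fn (zset f)" and y = y and z = 1 and d = "(*)", OF order_refl this] True show ?thesis
      by (auto simp: rc_const_def)
  next
    case False
    then have "f {y} \<le> idem_fn (zset f) {0}"
      by (simp add: idem_fn_at_zero[OF compl] le_coz[OF f])
    from rc_op_at_point[where f = f and g = "idem_fn (zset f)" and y = y and z = 0 and d = "(*)", OF order_refl this] show ?thesis
      by (auto simp: rc_const_def)
  qed
qed

text \<open>The function \<open>idem_fn a\<close> has cozero element \<open>a\<close>, so its idempotency is the case
  \<open>f = idem_fn a\<close> of the equation \<open>f \<cdot> idem_fn (coz f) = f\<close>.\<close>

lemma rc_mult_idem_fn_self:
  assumes "is_complement a (b :: 'a::frame)"
  shows "rc_op (*) (idem_fn a) (idem_fn a) = idem_fn a"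
  using rc_mult_idem_coz[OF frame_hom_idem_fn[OF assms]] by (simp add: coz_def idem_fn_def)

lemma (in monoid) idempotent_nat_pow:
  assumes "e \<in> carrier G" "e \<otimes> e = e" "n \<ge> (1::nat)"
  shows "e [^] n = e"
  using assms(3) by (induction n rule: dec_induct) (simp_all add: assms)

lemma Units_RL:
  assumes \<tau>: "topoframe \<tau>" and f: "real_continuous \<tau> f" and z: "zset f = bot"
  shows "f \<in> Units (RL \<tau>)"
proof -
  let ?g = "\<lambda>X. f (inverse -` X)"
  have hom: "frame_hom f" using f by (rule real_continuous_frame_hom)
  have "?g U \<in> \<tau>" if U: "open U" for U
  proof -
    \<comment> \<open>Removing the point \<open>0\<close>, where the reciprocal is discontinuous, does not change the value of \<open>f\<close>.\<close>
    have "open (inverse -` U \<inter> (UNIV - {0}) :: real set)"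
      using U continuous_on_open_vimage[of "UNIV - {0::real}" inverse]
      by (simp add: open_Diff continuous_on_inverse)
    then have "f (inverse -` U \<inter> (UNIV - {0})) \<in> \<tau>"
      using f by (simp add: real_continuous_iff_open[OF \<tau>])
    moreover have "coz f = top"
      using is_complement_zset_coz[OF hom] z by (simp add: is_complement_def)
    ultimately show ?thesis
      by (simp add: frame_hom_inf[OF hom] coz_def)
  qed
  then have g: "real_continuous \<tau> ?g"
    using hom by (simp add: real_continuous_iff_open[OF \<tau>] frame_hom_vimage)
  have "rc_op (*) ?g f = rc_const 1"
  proof (rule rc_op_inverse[OF hom])
    show "f {x} = bot \<or> inverse x * x = 1" for x
      using z by (cases "x = 0") (simp_all add: zset_def)
  qed
  moreover have "rc_op (*) f ?g = rc_op (*) ?g f"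
    using hom g by (intro rc_op_commute) (simp_all add: real_continuous_frame_hom)
  ultimately show ?thesis
    using f g by (auto simp: Units_def RL_simps)
qed

section \<open>Principal ideals annihilated by an idempotent\<close>

lemma (in cring) PIdl_not_essential:
  assumes f: "f \<in> carrier R" and e: "e \<in> carrier R" "e \<otimes> e = e" "e \<noteq> \<zero>" and fe: "f \<otimes> e = \<zero>"
  shows "\<not> essential_ideal (PIdl f) R"
proof -
  have "PIdl f \<inter> PIdl e = {\<zero>}"
  proof
    show "PIdl f \<inter> PIdl e \<subseteq> {\<zero>}"
    proof
      fix x assume "x \<in> PIdl f \<inter> PIdl e"
      then obtain r s where r: "r \<in> carrier R" "x = r \<otimes> f" and s: "s \<in> carrier R" "x = s \<otimes> e"
        by (auto simp: cgenideal_def)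
      have "x = x \<otimes> e" using s e by (simp add: m_assoc)
      also have "\<dots> = \<zero>" using r f e fe by (simp add: m_assoc)
      finally show "x \<in> {\<zero>}" by simp
    qed
    have "\<zero> \<in> PIdl a" if "a \<in> carrier R" for a
      using additive_subgroup.zero_closed cgenideal_ideal ideal_def that by blast
    then show "{\<zero>} \<subseteq> PIdl f \<inter> PIdl e" using f e by simp
  qed
  moreover have "PIdl e \<noteq> {\<zero>}" using cgenideal_self[OF e(1)] e(3) by auto
  ultimately show ?thesis
    using cgenideal_ideal[OF e(1)] by (auto simp: essential_ideal_def)
qed

lemma (in cring) PIdl_Unit:
  assumes "f \<in> Units R"
  shows "PIdl f = carrier R"
proof -
  have "inv f \<otimes> f \<in> PIdl f" using assms by (auto simp: cgenideal_def intro!: exI[of _ "inv f"])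
  then show ?thesis
    using ideal.one_imp_carrier[OF cgenideal_ideal[OF Units_closed[OF assms]]] assms by simp
qed

theorem proposition2:
  fixes \<tau> :: "'a::frame set" and f :: "real set \<Rightarrow> 'a"
  assumes "topoframe \<tau>" and "f \<in> carrier (RL \<tau>)"
  shows "(\<forall>n::nat. n \<ge> 1 \<longrightarrow> zset f \<in> \<tau> \<longrightarrow>
            f \<otimes>\<^bsub>RL \<tau>\<^esub> (idem_fn (coz f) [^]\<^bsub>RL \<tau>\<^esub> n) = f \<and>
            f \<otimes>\<^bsub>RL \<tau>\<^esub> (idem_fn (zset f) [^]\<^bsub>RL \<tau>\<^esub> n) = \<zero>\<^bsub>RL \<tau>\<^esub>) \<and>
         (f \<notin> Units (RL \<tau>) \<and> zset f \<in> \<tau> \<longrightarrow> zerodivisor (RL \<tau>) f) \<and>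
         (PIdl\<^bsub>RL \<tau>\<^esub> f \<noteq> carrier (RL \<tau>) \<and> zset f \<in> \<tau> \<longrightarrow>
            ideal (PIdl\<^bsub>RL \<tau>\<^esub> f) (RL \<tau>) \<and> \<not> essential_ideal (PIdl\<^bsub>RL \<tau>\<^esub> f) (RL \<tau>))"
proof -
  interpret R: cring "RL \<tau>" by (rule cring_RL[OF assms(1)])
  have f: "real_continuous \<tau> f" using assms(2) by (simp add: RL_simps)
  have hom: "frame_hom f" using f by (rule real_continuous_frame_hom)
  note zc = is_complement_zset_coz[OF hom]
  note cz = is_complement_sym[OF zc]
  let ?e = "idem_fn (zset f)" and ?c = "idem_fn (coz f)"
  have e_mult: "?e \<otimes>\<^bsub>RL \<tau>\<^esub> ?e = ?e" and c_mult: "?c \<otimes>\<^bsub>RL \<tau>\<^esub> ?c = ?c"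
    using rc_mult_idem_fn_self[OF zc] rc_mult_idem_fn_self[OF cz] by (simp_all add: RL_simps)
  have fe: "f \<otimes>\<^bsub>RL \<tau>\<^esub> ?e = \<zero>\<^bsub>RL \<tau>\<^esub>" and fc: "f \<otimes>\<^bsub>RL \<tau>\<^esub> ?c = f"
    using rc_mult_idem_zset[OF hom] rc_mult_idem_coz[OF hom] by (simp_all add: RL_simps)
  have carr: "?e \<in> carrier (RL \<tau>)" "?c \<in> carrier (RL \<tau>)" if "zset f \<in> \<tau>"
    using that coz_mem[OF assms(1) f] real_continuous_idem_fn[OF assms(1) zc]
      real_continuous_idem_fn[OF assms(1) cz] by (simp_all add: RL_simps)
  have e_nonzero: "?e \<noteq> \<zero>\<^bsub>RL \<tau>\<^esub>" if "f \<notin> Units (RL \<tau>)"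
  proof
    assume "?e = \<zero>\<^bsub>RL \<tau>\<^esub>"
    then have "?e {1} = rc_const 0 {1}" by (simp add: RL_simps)
    then have "zset f = bot" by (simp add: idem_fn_at_one rc_const_def)
    then show False using Units_RL[OF assms(1) f] that by blast
  qed
  have "f \<otimes>\<^bsub>RL \<tau>\<^esub> (?c [^]\<^bsub>RL \<tau>\<^esub> n) = f \<and> f \<otimes>\<^bsub>RL \<tau>\<^esub> (?e [^]\<^bsub>RL \<tau>\<^esub> n) = \<zero>\<^bsub>RL \<tau>\<^esub>"
    if "n \<ge> 1" "zset f \<in> \<tau>" for n :: nat
    using that carr fe fc e_mult c_mult by (simp add: R.idempotent_nat_pow)
  moreover have "zerodivisor (RL \<tau>) f" if "f \<notin> Units (RL \<tau>)" "zset f \<in> \<tau>"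
    using that assms(2) carr e_nonzero fe by (auto simp: zerodivisor_def)
  moreover have "\<not> essential_ideal (PIdl\<^bsub>RL \<tau>\<^esub> f) (RL \<tau>)"
    if "PIdl\<^bsub>RL \<tau>\<^esub> f \<noteq> carrier (RL \<tau>)" "zset f \<in> \<tau>"
    using that R.PIdl_Unit
    by (intro R.PIdl_not_essential[OF assms(2) carr(1) e_mult e_nonzero fe]) auto
  ultimately show ?thesis
    using R.cgenideal_ideal[OF assms(2)] by simp
qed

end
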